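(* Let $\{x^k\}_{k=0}^\infty$ be a sequence of iterates generated by the anisotropic proximal gradient method with step-size $\lambda$, where $0<\lambda<\lambda_g$ and $\lambda\le 1/L$. Then the sequence $\{F(x^k)\}_{k=0}^\infty$ is nonincreasing and convergent. In addition, every limit point $x^\star$ of $\{x^k\}_{k=0}^\infty$ is a stationary point of $F$, i.e., $0\in\nabla f(x^\star)+\partial g(x^\star)$. In particular, the minimum over the past regularized gaps vanishes sublinearly at rate $\mathcal{O}(1/K)$: for every $K\ge1$ $$\min_{k\in\{0,1,\ldots,K-1\}}\mathcal{G}_F^\phi(x^k,\lambda)\le\frac{1}{\lambda K}\big(F(x^0)-\inf F\big).$$
   Context: Reference function: $\phi:\mathbb{R}^n\to\mathbb{R}$ is convex with full domain and Legendre (essentially smooth and essentially strictly convex in the sense of Rockafellar); so $\nabla\phi:\mathbb{R}^n\to\operatorname{int}\operatorname{dom}\phi^*$ is a bijection with inverse $\nabla\phi^*$ ($\phi^*$ the convex conjugate). For $\lambda>0$, $(\lambda\star\phi)(x)=\lambda\phi(\lambda^{-1}x)$. Anisotropic descent property of $f\in\mathcal{C}^1(\mathbb{R}^n)$ relative to $\phi$ with constant $L>0$: $\operatorname{rge}\nabla f\subseteq\operatorname{rge}\nabla\phi$ (rge = range) and for all $\bar x,x\in\mathbb{R}^n$ $$f(x)\le f(\bar x)+\tfrac1L\star\phi\big(x-\bar x+L^{-1}\nabla\phi^*(\nabla f(\bar x))\big)-\tfrac1L\star\phi\big(L^{-1}\nabla\phi^*(\nabla f(\bar x))\big).$$ Problem: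 minimize $F:=f+g$, where $f\in\mathcal{C}^1(\mathbb{R}^n)$ has the anisotropic descent property relative to $\phi$ with constant $L>0$, $g:\mathbb{R}^n\to\overline{\mathbb{R}}$ is proper lower semicontinuous (not necessarily convex), and $\inf F>-\infty$. $\partial g$ is the limiting (Mordukhovich) subdifferential. Define $\lambda_g:=\sup\{\lambda>0: g+\lambda\star\phi(\cdot-y)\text{ is level-bounded for every }y\in\mathbb{R}^n\}$ (level-bounded: all sublevel sets are bounded); assume $\lambda_g>0$. Anisotropic proximal gradient method with step-size $\lambda$: starting from $x^0\in\mathbb{R}^n$, for $k=0,1,\ldots$ $$y^k=x^k-\lambda\nabla\phi^*(\nabla f(x^k)),\qquad x^{k+1}\in\operatorname*{arg\,min}_{x\in\mathbb{R}^n}\{g(x)+\lambda\star\phi(x-y^k)\}.$$ Regularized gap: for $0<\lambda<\lambda_g$, $\mathcal{G}_F^\phi(\bar x,\lambda):=\tfrac1\lambda\big(F(\bar x)-F_\lambda(\bar x)\big)$, where $$F_\lambda(\bar x):=\inf_{x\in\mathbb{R}^n}\Big\{f(\bar x)+\lambda\star\phi\big(x-\bar x+\lambda\nabla\phi^*(\nabla f(\bar x))\big)-\lambda\star\phi\big(\lambda\nabla\phi^*(\nabla f(\bar x))\big)+g(x)\Big\}.$$ *)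

theory Defs
  imports "HOL-Analysis.Analysis"
begin

definition gradient :: "('a::real_inner \<Rightarrow> real) \<Rightarrow> 'a \<Rightarrow> 'a" where
  "gradient f x = (THE D. GDERIV f x :> D)"

definition C1_function :: "('a::real_inner \<Rightarrow> real) \<Rightarrow> bool" where
  "C1_function f \<longleftrightarrow> (\<forall>x. f differentiable (at x)) \<and> continuous_on UNIV (gradient f)"

(* Only used at points near which h is finite. *)
definition egradient :: "('a::real_inner \<Rightarrow> ereal) \<Rightarrow> 'a \<Rightarrow> 'a" where
  "egradient h = gradient (\<lambda>x. real_of_ereal (h x))"

definition edomain :: "('a \<Rightarrow> ereal) \<Rightarrow> 'a set" where
  "edomain h = {x. h x < \<infinity>}"

definition proper_function :: "('a \<Rightarrow> ereal) \<Rightarrow> bool" where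
  "proper_function h \<longleftrightarrow> (\<forall>x. h x \<noteq> -\<infinity>) \<and> edomain h \<noteq> {}"

definition lower_semicontinuous :: "('a::topological_space \<Rightarrow> ereal) \<Rightarrow> bool" where
  "lower_semicontinuous h \<longleftrightarrow> (\<forall>x. h x \<le> Liminf (at x) h)"

definition level_bounded :: "('a::metric_space \<Rightarrow> ereal) \<Rightarrow> bool" where
  "level_bounded h \<longleftrightarrow> (\<forall>\<alpha>::real. bounded {x. h x \<le> ereal \<alpha>})"

definition convex_conjugate :: "('a::real_inner \<Rightarrow> real) \<Rightarrow> 'a \<Rightarrow> ereal" where
  "convex_conjugate \<phi> v = (SUP x. ereal (v \<bullet> x - \<phi> x))"

definition convex_subdifferential :: "('a::real_inner \<Rightarrow> ereal) \<Rightarrow> 'a \<Rightarrow> 'a set" where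
  "convex_subdifferential h x = {v. \<forall>z. h x + ereal (v \<bullet> (z - x)) \<le> h z}"

(* The next three definitions are those of Rockafellar (Convex Analysis, Section 26) for a
   proper convex function h; convexity is a separate hypothesis where they are used. *)

definition essentially_smooth :: "('a::euclidean_space \<Rightarrow> ereal) \<Rightarrow> bool" where
  "essentially_smooth h \<longleftrightarrow>
     interior (edomain h) \<noteq> {} \<and>
     (\<forall>x \<in> interior (edomain h). (\<lambda>z. real_of_ereal (h z)) differentiable (at x)) \<and>
     (\<forall>X b. (\<forall>i. X i \<in> interior (edomain h)) \<longrightarrow> b \<in> frontier (interior (edomain h)) \<longrightarrow>
        X \<longlonglongrightarrow> b \<longrightarrow> filterlim (\<lambda>i. norm (egradient h (X i))) at_top sequentially)"

definition essentially_strictly_convex :: "('a::euclidean_space \<Rightarrow> ereal) \<Rightarrow> bool" where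
  "essentially_strictly_convex h \<longleftrightarrow>
     (\<forall>S. convex S \<longrightarrow> S \<subseteq> {x. convex_subdifferential h x \<noteq> {}} \<longrightarrow>
       (\<forall>x\<in>S. \<forall>y\<in>S. \<forall>t::real. x \<noteq> y \<longrightarrow> 0 < t \<longrightarrow> t < 1 \<longrightarrow>
          h ((1 - t) *\<^sub>R x + t *\<^sub>R y) < ereal (1 - t) * h x + ereal t * h y))"

definition legendre :: "('a::euclidean_space \<Rightarrow> ereal) \<Rightarrow> bool" where
  "legendre h \<longleftrightarrow> essentially_smooth h \<and> essentially_strictly_convex h"

definition regular_subdifferential :: "('a::euclidean_space \<Rightarrow> ereal) \<Rightarrow> 'a \<Rightarrow> 'a set" where
  "regular_subdifferential h x =
     {v. \<bar>h x\<bar> \<noteq> \<infinity> \<and>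
         0 \<le> Liminf (at x) (\<lambda>z. (h z - h x - ereal (v \<bullet> (z - x))) / ereal (norm (z - x)))}"

definition limiting_subdifferential :: "('a::euclidean_space \<Rightarrow> ereal) \<Rightarrow> 'a \<Rightarrow> 'a set" where
  "limiting_subdifferential h x =
     {v. \<bar>h x\<bar> \<noteq> \<infinity> \<and>
         (\<exists>X V. X \<longlonglongrightarrow> x \<and> (\<lambda>i. h (X i)) \<longlonglongrightarrow> h x \<and>
                (\<forall>i. V i \<in> regular_subdifferential h (X i)) \<and> V \<longlonglongrightarrow> v)}"

definition epi_scale :: "real \<Rightarrow> ('a::real_vector \<Rightarrow> real) \<Rightarrow> 'a \<Rightarrow> real" (infixr "\<star>" 75) where
  "(c \<star> \<phi>) x = c * \<phi> (inverse c *\<^sub>R x)"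

definition precond_grad ::
    "('a::euclidean_space \<Rightarrow> real) \<Rightarrow> ('a \<Rightarrow> real) \<Rightarrow> 'a \<Rightarrow> 'a" where
  "precond_grad \<phi> f x = egradient (convex_conjugate \<phi>) (gradient f x)"

definition anisotropic_descent ::
    "('a::euclidean_space \<Rightarrow> real) \<Rightarrow> ('a \<Rightarrow> real) \<Rightarrow> real \<Rightarrow> bool" where
  "anisotropic_descent \<phi> f L \<longleftrightarrow>
     range (gradient f) \<subseteq> range (gradient \<phi>) \<and>
     (\<forall>xb x. f x \<le> f xb + ((1 / L) \<star> \<phi>) (x - xb + (1 / L) *\<^sub>R precond_grad \<phi> f xb)
                        - ((1 / L) \<star> \<phi>) ((1 / L) *\<^sub>R precond_grad \<phi> f xb))"

(* The supremum is taken in the extended reals. *)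
definition prox_threshold ::
    "('a::euclidean_space \<Rightarrow> real) \<Rightarrow> ('a \<Rightarrow> ereal) \<Rightarrow> ereal" where
  "prox_threshold \<phi> g =
     Sup {ereal c | c. 0 < c \<and> (\<forall>y. level_bounded (\<lambda>x. g x + ereal ((c \<star> \<phi>) (x - y))))}"

definition objective :: "('a \<Rightarrow> real) \<Rightarrow> ('a \<Rightarrow> ereal) \<Rightarrow> 'a \<Rightarrow> ereal" where
  "objective f g x = ereal (f x) + g x"

definition aniso_prox_grad_iterates ::
    "('a::euclidean_space \<Rightarrow> real) \<Rightarrow> ('a \<Rightarrow> real) \<Rightarrow> ('a \<Rightarrow> ereal) \<Rightarrow> real \<Rightarrow> (nat \<Rightarrow> 'a) \<Rightarrow> bool" where
  "aniso_prox_grad_iterates \<phi> f g c x \<longleftrightarrow>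
     (\<exists>y. \<forall>k. y k = x k - c *\<^sub>R precond_grad \<phi> f (x k) \<and>
          is_arg_min (\<lambda>z. g z + ereal ((c \<star> \<phi>) (z - y k))) (\<lambda>_. True) (x (Suc k)))"

definition aniso_envelope ::
    "('a::euclidean_space \<Rightarrow> real) \<Rightarrow> ('a \<Rightarrow> real) \<Rightarrow> ('a \<Rightarrow> ereal) \<Rightarrow> real \<Rightarrow> 'a \<Rightarrow> ereal" where
  "aniso_envelope \<phi> f g c xb =
     (INF x. ereal (f xb + (c \<star> \<phi>) (x - xb + c *\<^sub>R precond_grad \<phi> f xb)
                         - (c \<star> \<phi>) (c *\<^sub>R precond_grad \<phi> f xb)) + g x)"

definition regularized_gap ::
    "('a::euclidean_space \<Rightarrow> real) \<Rightarrow> ('a \<Rightarrow> real) \<Rightarrow> ('a \<Rightarrow> ereal) \<Rightarrow> 'a \<Rightarrow> real \<Rightarrow> ereal" where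
  "regularized_gap \<phi> f g xb c =
     ereal (1 / c) * (objective f g xb - aniso_envelope \<phi> f g c xb)"

definition stationary_point ::
    "('a::euclidean_space \<Rightarrow> real) \<Rightarrow> ('a \<Rightarrow> ereal) \<Rightarrow> 'a \<Rightarrow> bool" where
  "stationary_point f g x \<longleftrightarrow> 0 \<in> (\<lambda>v. gradient f x + v) ` limiting_subdifferential g x"

end

theory Submission
  imports Defs
begin

text \<open>The iteration is a majorization-minimization scheme. Freezing the gradient of \<open>f\<close> at \<open>y\<close>
gives the model
\<open>m\<^sub>y z = f y + (lam \<star> \<phi>) (z - y + lam v) - (lam \<star> \<phi>) (lam v)\<close> with
\<open>v = \<nabla>\<phi>\<^sup>* (\<nabla>f y)\<close>, and \<open>x (Suc k)\<close> minimizes \<open>m + g\<close> for the model \<open>m\<close> at \<open>x k\<close>. The model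
touches \<open>f\<close> at \<open>y\<close>, and it lies above \<open>f\<close>: for step-size \<open>1/L\<close> this is the descent property, and
a smaller step-size only raises the model because \<open>c * (\<phi> (v + d/c) - \<phi> v)\<close> is a perspective of
a convex function vanishing at 0 (\<open>convex_perspective_antimono\<close>). Hence, with \<open>F = f + g\<close> and for
every \<open>z\<close>,
\<open>F (x (Suc k)) \<le> m z + g z\<close> (\<open>objective_step_le\<close>). Everything else follows from this inequality.

Taking \<open>z = x k\<close> gives the decrease of \<open>F\<close>, and a decreasing sequence that is bounded below
converges to some \<open>l\<close>. Taking the infimum over \<open>z\<close> bounds \<open>lam\<close> times the gap at \<open>x k\<close> by
\<open>F (x k) - F (x (Suc k))\<close>, and these bounds telescope.

For a limit point \<open>y\<close>, the inequality is weakened to \<open>l \<le> m z + g z\<close> and passed to the limit in the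
base point of the model. With \<open>F y \<le> l\<close>, which is lower semicontinuity, this says that \<open>y\<close> itself minimizes
\<open>m\<^sub>y + g\<close>. The derivative of \<open>m\<^sub>y\<close> at \<open>y\<close> is \<open>\<nabla>\<phi> v = \<nabla>f y\<close>, and Fermat's rule puts \<open>- \<nabla>f y\<close> into the
regular, hence into the limiting, subdifferential of \<open>g\<close> at \<open>y\<close>.

Two facts from Legendre duality enter: \<open>\<nabla>\<phi>\<^sup>*\<close> inverts \<open>\<nabla>\<phi>\<close>, and it is continuous on the range of
\<open>\<nabla>\<phi>\<close>. Both come from one estimate (\<open>legendre_linear_growth\<close>): outside any ball around
\<open>v\<close>, the strictly convex \<open>\<phi>\<close> exceeds its tangent at \<open>v\<close> by a positive multiple of the distance.\<close>

section \<open>Gradients and strict tangents\<close>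

lemma gradient_eqI: "GDERIV f x :> D \<Longrightarrow> gradient f x = D"
  unfolding gradient_def
proof (rule the_equality)
  fix D' assume D: "GDERIV f x :> D" and D': "GDERIV f x :> D'"
  then have "(\<lambda>h. h \<bullet> D) = (\<lambda>h. h \<bullet> D')"
    unfolding gderiv_def by (rule has_derivative_unique)
  then show "D' = D"
    by (simp add: fun_eq_iff vector_eq_ldot)
qed

lemma GDERIV_gradient:
  fixes f :: "'a::euclidean_space \<Rightarrow> real"
  assumes "f differentiable (at x)"
  shows "GDERIV f x :> gradient f x"
proof -
  obtain f' where f': "(f has_derivative f') (at x)"
    using assms by (auto simp: differentiable_def)
  then interpret linear f'
    by (simp add: has_derivative_linear)
  have "f' = (\<lambda>h. h \<bullet> (\<Sum>b\<in>Basis. f' b *\<^sub>R b))"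
  proof
    fix h
    have "f' h = f' (\<Sum>b\<in>Basis. (h \<bullet> b) *\<^sub>R b)"
      by (simp add: euclidean_representation)
    also have "\<dots> = (\<Sum>b\<in>Basis. (h \<bullet> b) * f' b)"
      by (simp add: sum scale)
    finally show "f' h = h \<bullet> (\<Sum>b\<in>Basis. f' b *\<^sub>R b)"
      by (simp add: inner_sum_right mult.commute)
  qed
  then have "GDERIV f x :> (\<Sum>b\<in>Basis. f' b *\<^sub>R b)"
    unfolding gderiv_def using f' by metis
  with gradient_eqI[OF this] show ?thesis
    by simp
qed

text \<open>The difference quotient of \<open>\<phi>\<close> along the segment from \<open>v\<close> to \<open>z\<close> is at most its value at the far
end; its limit at \<open>v\<close> is the directional derivative.\<close>

lemma convex_tangent_le:
  fixes \<phi> :: "'a::euclidean_space \<Rightarrow> real"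
  assumes cvx: "convex_on UNIV \<phi>" and p: "GDERIV \<phi> v :> p"
  shows "\<phi> v + p \<bullet> (z - v) \<le> \<phi> z"
proof -
  define h where "h t = \<phi> (v + t *\<^sub>R (z - v))" for t :: real
  have "((\<lambda>t::real. v + t *\<^sub>R (z - v)) has_derivative (\<lambda>t. t *\<^sub>R (z - v))) (at 0)"
    by (auto intro!: derivative_eq_intros)
  from has_derivative_compose[OF this, of \<phi> "\<lambda>d. d \<bullet> p"] p
  have "(h has_derivative (\<lambda>t. t *\<^sub>R (z - v) \<bullet> p)) (at 0)"
    by (simp add: gderiv_def h_def[abs_def])
  then have "(h has_real_derivative (p \<bullet> (z - v))) (at 0)"
    by (rule has_derivative_imp_has_field_derivative) (simp add: inner_commute)
  then have "((\<lambda>t. (h t - h 0) / t) \<longlongrightarrow> p \<bullet> (z - v)) (at_right 0)"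
    by (simp add: has_field_derivative_iff filterlim_at_split)
  moreover have "\<forall>\<^sub>F t in at_right 0. (h t - h 0) / t \<le> \<phi> z - \<phi> v"
    using eventually_at_right_real[OF zero_less_one]
  proof eventually_elim
    case (elim t)
    have "h t = \<phi> ((1 - t) *\<^sub>R v + t *\<^sub>R z)"
      by (simp add: h_def algebra_simps)
    also have "\<dots> \<le> (1 - t) * \<phi> v + t * \<phi> z"
      using elim by (intro convex_onD[OF cvx]) auto
    finally have "h t - h 0 \<le> (\<phi> z - \<phi> v) * t"
      by (simp add: h_def algebra_simps)
    then show ?case
      using elim by (simp add: divide_simps)
  qed
  ultimately have "p \<bullet> (z - v) \<le> \<phi> z - \<phi> v"
    by (rule tendsto_upperbound) simp
  then show ?thesis by simp
qed

lemma legendre_differentiable: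
  assumes "legendre (\<lambda>z. ereal (\<phi> z))"
  shows "\<phi> differentiable (at x)"
  using assms by (auto simp: legendre_def essentially_smooth_def edomain_def)

text \<open>A finite differentiable convex function has subgradients everywhere, so essential strict
convexity is strict convexity on the whole space. Comparing the value at the midpoint with the
tangent there makes the tangent inequality strict.\<close>

lemma legendre_strict_tangent:
  fixes \<phi> :: "'a::euclidean_space \<Rightarrow> real"
  assumes cvx: "convex_on UNIV \<phi>" and leg: "legendre (\<lambda>z. ereal (\<phi> z))"
    and p: "GDERIV \<phi> v :> p" and "z \<noteq> v"
  shows "\<phi> v + p \<bullet> (z - v) < \<phi> z"
proof -
  have sub: "UNIV \<subseteq> {x. convex_subdifferential (\<lambda>z. ereal (\<phi> z)) x \<noteq> {}}"
    using convex_tangent_le[OF cvx GDERIV_gradient[OF legendre_differentiable[OF leg]]]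
    by (auto simp: convex_subdifferential_def)
  let ?m = "(1 - 1/2) *\<^sub>R v + (1/2::real) *\<^sub>R z"
  have "ereal (\<phi> ?m) < ereal (1 - 1/2) * ereal (\<phi> v) + ereal (1/2) * ereal (\<phi> z)"
    using leg[unfolded legendre_def essentially_strictly_convex_def, THEN conjunct2, rule_format,
        OF convex_UNIV sub, of v z "1/2"] \<open>z \<noteq> v\<close> by simp
  then have "\<phi> ?m < \<phi> v / 2 + \<phi> z / 2"
    by simp
  moreover have "\<phi> v + p \<bullet> (?m - v) \<le> \<phi> ?m"
    by (rule convex_tangent_le[OF cvx p])
  moreover have "p \<bullet> (?m - v) = p \<bullet> (z - v) / 2"
    by (simp add: inner_diff_right inner_add_right field_simps)
  ultimately show ?thesis
    by linarith
qed

section \<open>Inverting the gradient of the reference function\<close>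

text \<open>The excess of \<open>\<phi>\<close> over its tangent at \<open>v\<close> is convex and vanishes at \<open>v\<close>. On the compact sphere of
radius \<open>r\<close> it has a positive minimum, and along rays from \<open>v\<close> it then grows at least linearly.
The slope \<open>m\<close> is that minimum divided by \<open>r\<close>.\<close>

lemma legendre_linear_growth:
  fixes \<phi> :: "'a::euclidean_space \<Rightarrow> real"
  assumes cvx: "convex_on UNIV \<phi>" and leg: "legendre (\<lambda>z. ereal (\<phi> z))"
    and p: "GDERIV \<phi> v :> p" and "0 < r"
  obtains m where "0 < m"
    "\<And>x. r \<le> norm (x - v) \<Longrightarrow> \<phi> v + p \<bullet> (x - v) + m * norm (x - v) \<le> \<phi> x"
proof -
  define h where "h x = \<phi> x - \<phi> v - p \<bullet> (x - v)" for x
  have "continuous_on (sphere v r) h"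
    unfolding h_def
    by (intro continuous_intros differentiable_imp_continuous_on differentiable_at_imp_differentiable_on)
       (simp add: legendre_differentiable[OF leg])
  moreover have "sphere v r \<noteq> {}"
    using \<open>0 < r\<close> by simp
  ultimately obtain w where w: "w \<in> sphere v r" "\<And>y. y \<in> sphere v r \<Longrightarrow> h w \<le> h y"
    using continuous_attains_inf[of "sphere v r" h] by auto
  have "w \<noteq> v"
    using w \<open>0 < r\<close> by auto
  then have pos: "0 < h w"
    using legendre_strict_tangent[OF cvx leg p] by (simp add: h_def algebra_simps)
  have "\<phi> v + p \<bullet> (x - v) + h w / r * norm (x - v) \<le> \<phi> x" if x: "r \<le> norm (x - v)" for x
  proof -
    define t where "t = r / norm (x - v)"
    have t: "0 < t" "t \<le> 1"
      using x \<open>0 < r\<close> by (auto simp: t_def divide_simps)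
    have "norm (x - v) > 0"
      using x \<open>0 < r\<close> by linarith
    \<comment> \<open>the point where the segment from \<open>v\<close> to \<open>x\<close> crosses the sphere\<close>
    let ?y = "(1 - t) *\<^sub>R v + t *\<^sub>R x"
    have yv: "?y - v = t *\<^sub>R (x - v)"
      by (simp add: algebra_simps)
    have "norm (?y - v) = r"
      unfolding yv using \<open>0 < r\<close> \<open>norm (x - v) > 0\<close> by (simp add: t_def)
    then have "h w \<le> h ?y"
      using w(2) by (metis dist_commute dist_norm mem_sphere)
    also have "h ?y = \<phi> ?y - \<phi> v - t * (p \<bullet> (x - v))"
      unfolding h_def yv by simp
    also have "\<phi> ?y \<le> (1 - t) * \<phi> v + t * \<phi> x"
      using t by (intro convex_onD[OF cvx]) auto
    finally have "h w \<le> t * h x"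
      by (simp add: h_def algebra_simps)
    then have "h w / t \<le> h x"
      using t by (simp add: pos_divide_le_eq mult.commute)
    then show ?thesis
      by (simp add: t_def h_def)
  qed
  then show ?thesis
    using that[of "h w / r"] pos \<open>0 < r\<close> by simp
qed

text \<open>The conjugate is a supremum of affine functions, the one given by \<open>v\<close> being exact at \<open>p\<close>; this is
a lower bound with slope \<open>v\<close>. For the upper bound, fix \<open>r\<close> and let \<open>m\<close> be the slope from
\<open>legendre_linear_growth\<close>. When \<open>q\<close> is closer to \<open>p\<close> than \<open>m\<close>, points farther than \<open>r\<close> from
\<open>v\<close> lose more than the change of slope gains, and the nearer points contribute an error of at
most \<open>r\<close> times the distance of \<open>q\<close> and \<open>p\<close>. Since \<open>r\<close> is arbitrary, this is differentiability.\<close>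

lemma gradient_convex_conjugate:
  fixes \<phi> :: "'a::euclidean_space \<Rightarrow> real"
  assumes cvx: "convex_on UNIV \<phi>" and leg: "legendre (\<lambda>z. ereal (\<phi> z))"
    and p: "GDERIV \<phi> v :> p"
  shows "egradient (convex_conjugate \<phi>) p = v"
proof -
  let ?c = "\<lambda>q. real_of_ereal (convex_conjugate \<phi> q)"
  have lower: "ereal (q \<bullet> v - \<phi> v) \<le> convex_conjugate \<phi> q" for q
    unfolding convex_conjugate_def by (rule SUP_upper) simp
  have near: "\<exists>d>0. \<forall>q. norm (q - p) < d \<longrightarrow>
      convex_conjugate \<phi> q \<le> ereal (q \<bullet> v - \<phi> v + r * norm (q - p))" if "0 < r" for r
  proof -
    obtain m where m: "0 < m"
      "\<And>x. r \<le> norm (x - v) \<Longrightarrow> \<phi> v + p \<bullet> (x - v) + m * norm (x - v) \<le> \<phi> x"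
      using legendre_linear_growth[OF cvx leg p \<open>0 < r\<close>] by blast
    have "q \<bullet> x - \<phi> x \<le> q \<bullet> v - \<phi> v + r * norm (q - p)" if q: "norm (q - p) < m" for q x
    proof -
      have cs: "(q - p) \<bullet> (x - v) \<le> norm (q - p) * norm (x - v)"
        by (rule norm_cauchy_schwarz)
      show ?thesis
      proof (cases "r \<le> norm (x - v)")
        case True
        have "norm (q - p) * norm (x - v) \<le> m * norm (x - v)"
          using q by (intro mult_right_mono) auto
        moreover have "0 \<le> r * norm (q - p)"
          using \<open>0 < r\<close> by simp
        ultimately show ?thesis
          using cs m(2)[OF True] by (simp add: inner_diff_left inner_diff_right)
      next
        case False
        then have "norm (q - p) * norm (x - v) \<le> norm (q - p) * r"
          by (intro mult_left_mono) auto
        then show ?thesis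
          using cs convex_tangent_le[OF cvx p, of x]
          by (simp add: inner_diff_left inner_diff_right mult.commute)
      qed
    qed
    then show ?thesis
      using m(1) unfolding convex_conjugate_def by (intro exI[of _ m]) (auto intro!: SUP_least)
  qed
  have "convex_conjugate \<phi> p \<le> ereal (p \<bullet> v - \<phi> v)"
  proof -
    obtain d where "d > 0" "\<forall>q. norm (q - p) < d \<longrightarrow>
        convex_conjugate \<phi> q \<le> ereal (q \<bullet> v - \<phi> v + 1 * norm (q - p))"
      using near[OF zero_less_one] by blast
    from this(2)[rule_format, of p] this(1) show ?thesis by simp
  qed
  then have "convex_conjugate \<phi> p = ereal (p \<bullet> v - \<phi> v)"
    using lower[of p] by (rule antisym)
  then have cp: "?c p = p \<bullet> v - \<phi> v"
    by simp
  have "\<exists>d>0. \<forall>q. norm (q - p) < d \<longrightarrow>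
      norm (?c q - ?c p - (q - p) \<bullet> v) \<le> r * norm (q - p)" if r: "0 < r" for r
  proof -
    obtain d where d: "d > 0" "\<And>q. norm (q - p) < d \<Longrightarrow>
        convex_conjugate \<phi> q \<le> ereal (q \<bullet> v - \<phi> v + r * norm (q - p))"
      using near[OF r] by blast
    have "norm (?c q - ?c p - (q - p) \<bullet> v) \<le> r * norm (q - p)" if "norm (q - p) < d" for q
    proof -
      have "q \<bullet> v - \<phi> v \<le> ?c q \<and> ?c q \<le> q \<bullet> v - \<phi> v + r * norm (q - p)"
        using d(2)[OF that] lower[of q] by (cases "convex_conjugate \<phi> q") auto
      then show ?thesis
        unfolding cp by (simp add: inner_diff_left abs_le_iff)
    qed
    with d(1) show ?thesis by blast
  qed
  then have "GDERIV ?c p :> v"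
    unfolding gderiv_def has_derivative_at_alt using bounded_linear_inner_left by blast
  then show ?thesis
    unfolding egradient_def by (rule gradient_eqI)
qed

text \<open>If \<open>w n\<close> stayed at distance at least \<open>r\<close> from \<open>v\<close>, the linear growth of \<open>\<phi>\<close> around \<open>v\<close> would contradict
the tangent inequality at \<open>w n\<close> as soon as the slopes \<open>q n\<close> and \<open>p\<close> differ by less than \<open>m\<close>.\<close>

lemma gradient_inverse_continuous:
  fixes \<phi> :: "'a::euclidean_space \<Rightarrow> real"
  assumes cvx: "convex_on UNIV \<phi>" and leg: "legendre (\<lambda>z. ereal (\<phi> z))"
    and p: "GDERIV \<phi> v :> p" and q: "\<And>n. GDERIV \<phi> (w n) :> q n"
    and lim: "q \<longlonglongrightarrow> p"
  shows "w \<longlonglongrightarrow> v"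
proof (rule tendstoI)
  fix r :: real assume "0 < r"
  obtain m where m: "0 < m"
    "\<And>x. r \<le> norm (x - v) \<Longrightarrow> \<phi> v + p \<bullet> (x - v) + m * norm (x - v) \<le> \<phi> x"
    using legendre_linear_growth[OF cvx leg p \<open>0 < r\<close>] by blast
  show "\<forall>\<^sub>F n in sequentially. dist (w n) v < r"
    using tendstoD[OF lim m(1)]
  proof eventually_elim
    case (elim n)
    show ?case
    proof (rule ccontr)
      assume "\<not> ?case"
      then have far: "r \<le> norm (w n - v)"
        by (simp add: dist_norm)
      have "norm (q n - p) * norm (w n - v) < m * norm (w n - v)"
        using elim far \<open>0 < r\<close> by (intro mult_strict_right_mono) (auto simp: dist_norm)
      then have "(q n - p) \<bullet> (w n - v) < m * norm (w n - v)"
        using norm_cauchy_schwarz[of "q n - p" "w n - v"] by linarith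
      then show False
        using m(2)[OF far] convex_tangent_le[OF cvx q, of n v]
        by (simp add: inner_diff_left inner_diff_right)
    qed
  qed
qed

section \<open>Subdifferentials and lower semicontinuity\<close>

text \<open>Fermat's rule: at a minimizer, \<open>g\<close> decreases no faster than the smooth term increases, and the
latter increases like \<open>q\<close> up to an error of smaller order than the distance.\<close>

lemma fermat_regular_subdifferential:
  fixes g :: "'a::euclidean_space \<Rightarrow> ereal"
  assumes q: "GDERIV \<psi> x :> q" and fin: "\<bar>g x\<bar> \<noteq> \<infinity>"
    and min: "\<And>z. ereal (\<psi> x) + g x \<le> ereal (\<psi> z) + g z"
  shows "- q \<in> regular_subdifferential g x"
proof -
  let ?Q = "\<lambda>z. (g z - g x - ereal ((- q) \<bullet> (z - x))) / ereal (norm (z - x))"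
  obtain a where a: "g x = ereal a"
    using fin by auto
  have liminf: "ereal (- e) \<le> Liminf (at x) ?Q" if "0 < e" for e
  proof (rule Liminf_bounded)
    obtain d where d: "d > 0" "\<And>z. norm (z - x) < d \<Longrightarrow>
        norm (\<psi> z - \<psi> x - (z - x) \<bullet> q) \<le> e * norm (z - x)"
      using q \<open>0 < e\<close> unfolding gderiv_def has_derivative_at_alt by blast
    show "\<forall>\<^sub>F z in at x. ereal (- e) \<le> ?Q z"
      unfolding eventually_at
    proof (intro exI conjI ballI impI)
      fix z assume z: "z \<noteq> x \<and> dist z x < d"
      then have n: "norm (z - x) > 0" and b: "\<psi> z - \<psi> x - (z - x) \<bullet> q \<le> e * norm (z - x)"
        using d(2)[of z] by (auto simp: dist_norm)
      show "ereal (- e) \<le> ?Q z"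
      proof (cases "g z")
        case (real b)
        then have "\<psi> x + a \<le> \<psi> z + b"
          using min[of z] a by simp
        then have "- e * norm (z - x) \<le> b - a - (- q) \<bullet> (z - x)"
          using b by (simp add: inner_commute)
        then have "- e \<le> (b - a - (- q) \<bullet> (z - x)) / norm (z - x)"
          using n by (simp add: pos_le_divide_eq)
        then show ?thesis
          using real a n by simp
      next
        case PInf
        then show ?thesis using a n by simp
      next
        case MInf
        then show ?thesis using min[of z] a by simp
      qed
    qed (rule d(1))
  qed
  have "0 \<le> Liminf (at x) ?Q + ereal e" if "0 < e" for e
    using liminf[OF that] by (cases "Liminf (at x) ?Q") (auto simp: zero_ereal_def)
  then have "0 \<le> Liminf (at x) ?Q"
    by (rule ereal_le_epsilon2)
  then show ?thesis
    using fin by (simp add: regular_subdifferential_def)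
qed

lemma regular_subset_limiting:
  "regular_subdifferential h x \<subseteq> limiting_subdifferential h x"
proof
  fix v assume v: "v \<in> regular_subdifferential h x"
  show "v \<in> limiting_subdifferential h x"
    unfolding limiting_subdifferential_def mem_Collect_eq
  proof (intro conjI exI)
    show "\<bar>h x\<bar> \<noteq> \<infinity>"
      using v by (simp add: regular_subdifferential_def)
    show "\<forall>i. (\<lambda>_::nat. v) i \<in> regular_subdifferential h ((\<lambda>_. x) i)"
      using v by simp
  qed auto
qed

text \<open>The lower limit in the definition excludes the point itself; a sequence may hit \<open>x\<close>, where
the bound holds as well.\<close>

lemma lower_semicontinuous_sequentially:
  assumes lsc: "lower_semicontinuous h" and X: "X \<longlonglongrightarrow> x" and "t < h x"
  shows "\<forall>\<^sub>F n in sequentially. t < h (X n)"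
proof -
  have "t < Liminf (at x) h"
    using lsc \<open>t < h x\<close> by (auto simp: lower_semicontinuous_def intro: less_le_trans)
  then have "\<forall>\<^sub>F z in at x. t < h z"
    by (rule less_LiminfD)
  then have "\<forall>\<^sub>F z in nhds x. t < h z"
    unfolding eventually_at_filter by eventually_elim (use \<open>t < h x\<close> in auto)
  then show ?thesis
    using X unfolding filterlim_iff by blast
qed

lemma objective_le_lim:
  assumes lsc: "lower_semicontinuous g" and f: "isCont f x" and X: "X \<longlonglongrightarrow> x"
    and lim: "(\<lambda>n. objective f g (X n)) \<longlonglongrightarrow> ereal l"
  shows "objective f g x \<le> ereal l"
proof (rule ccontr)
  assume "\<not> objective f g x \<le> ereal l"
  then have "ereal (l - f x) < g x"
    by (cases "g x") (auto simp: objective_def)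
  then obtain t where t: "ereal (l - f x) < ereal t" "ereal t < g x"
    using ereal_dense2 by blast
  have "\<forall>\<^sub>F n in sequentially. ereal (f (X n) + t) \<le> objective f g (X n)"
    using lower_semicontinuous_sequentially[OF lsc X t(2)]
  proof eventually_elim
    case (elim n)
    then show ?case
      by (cases "g (X n)") (auto simp: objective_def)
  qed
  moreover have "(\<lambda>n. ereal (f (X n) + t)) \<longlonglongrightarrow> ereal (f x + t)"
    by (intro tendsto_ereal tendsto_add tendsto_const isCont_tendsto_compose[OF f X])
  ultimately have "ereal (f x + t) \<le> ereal l"
    by (intro tendsto_le[OF trivial_limit_sequentially lim])
  then show False
    using t(1) by simp
qed

section \<open>The anisotropic model\<close>

text \<open>The point \<open>v + d/c'\<close> lies on the segment from \<open>v\<close> to \<open>v + d/c\<close>, at the fraction \<open>c/c'\<close>.\<close>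

lemma convex_perspective_antimono:
  fixes \<phi> :: "'a::real_vector \<Rightarrow> real"
  assumes cvx: "convex_on UNIV \<phi>" and "0 < c" "c \<le> c'"
  shows "c' * (\<phi> (v + inverse c' *\<^sub>R d) - \<phi> v) \<le> c * (\<phi> (v + inverse c *\<^sub>R d) - \<phi> v)"
proof -
  define t where "t = c / c'"
  have t: "0 \<le> t" "t \<le> 1" "c' > 0" "c' * t = c"
    using assms by (auto simp: t_def)
  have "v + inverse c' *\<^sub>R d = (1 - t) *\<^sub>R v + t *\<^sub>R (v + inverse c *\<^sub>R d)"
    using assms by (simp add: t_def algebra_simps divide_inverse)
  then have "\<phi> (v + inverse c' *\<^sub>R d) \<le> (1 - t) * \<phi> v + t * \<phi> (v + inverse c *\<^sub>R d)"
    using t convex_onD[OF cvx, of t v "v + inverse c *\<^sub>R d"] by simp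
  then have "c' * (\<phi> (v + inverse c' *\<^sub>R d) - \<phi> v) \<le> c' * (t * (\<phi> (v + inverse c *\<^sub>R d) - \<phi> v))"
    using t by (intro mult_left_mono) (auto simp: algebra_simps)
  then show ?thesis
    using t(4) by (simp flip: mult.assoc)
qed

text \<open>The function of \<open>z\<close> whose sum with \<open>g\<close> is minimized in the envelope. Up to a constant it is the
scaled reference function centred at the forward step from \<open>xb\<close>, so a proximal step minimizes
the same sum.\<close>

definition aniso_model ::
    "('a::euclidean_space \<Rightarrow> real) \<Rightarrow> ('a \<Rightarrow> real) \<Rightarrow> real \<Rightarrow> 'a \<Rightarrow> 'a \<Rightarrow> real" where
  "aniso_model \<phi> f c xb z = f xb + (c \<star> \<phi>) (z - xb + c *\<^sub>R precond_grad \<phi> f xb)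
     - (c \<star> \<phi>) (c *\<^sub>R precond_grad \<phi> f xb)"

lemma aniso_model_eq:
  assumes "0 < c"
  shows "aniso_model \<phi> f c xb z = f xb +
    c * (\<phi> (precond_grad \<phi> f xb + inverse c *\<^sub>R (z - xb)) - \<phi> (precond_grad \<phi> f xb))"
  using assms by (simp add: aniso_model_def epi_scale_def algebra_simps)

lemma aniso_envelope_eq:
  "aniso_envelope \<phi> f g c xb = (INF z. ereal (aniso_model \<phi> f c xb z) + g z)"
  unfolding aniso_envelope_def aniso_model_def ..

lemma aniso_model_self: "0 < c \<Longrightarrow> aniso_model \<phi> f c xb xb = f xb"
  unfolding aniso_model_eq by simp

section \<open>Problems with the anisotropic descent property\<close>

locale anisotropic_composite =
  fixes \<phi> f :: "'a::euclidean_space \<Rightarrow> real" and g :: "'a \<Rightarrow> ereal" and L c :: real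
  assumes convex: "convex_on UNIV \<phi>"
    and legendre: "legendre (\<lambda>z. ereal (\<phi> z))"
    and C1: "C1_function f"
    and descent: "anisotropic_descent \<phi> f L"
    and proper: "proper_function g"
    and lsc: "lower_semicontinuous g"
    and step_pos: "0 < c"
    and step_le: "c \<le> 1 / L"
begin

text \<open>The range condition in the descent property makes every gradient of \<open>f\<close> a gradient of \<open>\<phi>\<close>, and
there the gradient of the conjugate recovers the point.\<close>

lemma GDERIV_reference: "GDERIV \<phi> (precond_grad \<phi> f y) :> gradient f y"
proof -
  obtain v where v: "gradient f y = gradient \<phi> v"
    using descent unfolding anisotropic_descent_def by blast
  have "GDERIV \<phi> v :> gradient f y"
    unfolding v by (rule GDERIV_gradient[OF legendre_differentiable[OF legendre]])
  then show ?thesis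
    using gradient_convex_conjugate[OF convex legendre] by (simp add: precond_grad_def)
qed

lemma precond_grad_tendsto:
  assumes "X \<longlonglongrightarrow> y"
  shows "(\<lambda>n. precond_grad \<phi> f (X n)) \<longlonglongrightarrow> precond_grad \<phi> f y"
proof (rule gradient_inverse_continuous[OF convex legendre GDERIV_reference GDERIV_reference])
  have "isCont (gradient f) y"
    using C1 by (simp add: C1_function_def continuous_on_eq_continuous_at)
  then show "(\<lambda>n. gradient f (X n)) \<longlonglongrightarrow> gradient f y"
    using assms by (rule isCont_tendsto_compose)
qed

lemma isCont_f: "isCont f y"
  using C1 by (simp add: C1_function_def differentiable_imp_continuous_within)

lemma model_tendsto:
  assumes "X \<longlonglongrightarrow> y"
  shows "(\<lambda>n. aniso_model \<phi> f c (X n) z) \<longlonglongrightarrow> aniso_model \<phi> f c y z"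
proof -
  have "isCont \<phi> v" for v
    by (rule differentiable_imp_continuous_within[OF legendre_differentiable[OF legendre]])
  note \<phi> = isCont_tendsto_compose[OF this]
  show ?thesis
    unfolding aniso_model_eq[OF step_pos]
    by (intro tendsto_intros \<phi> isCont_tendsto_compose[OF isCont_f] precond_grad_tendsto assms)
qed

lemma model_GDERIV: "GDERIV (aniso_model \<phi> f c y) y :> gradient f y"
proof -
  let ?v = "precond_grad \<phi> f y" and ?p = "gradient f y"
  have "((\<lambda>z. ?v + inverse c *\<^sub>R (z - y)) has_derivative (\<lambda>h. inverse c *\<^sub>R h)) (at y)"
    by (auto intro!: derivative_eq_intros)
  from has_derivative_compose[OF this, of \<phi> "\<lambda>h. h \<bullet> ?p"]
  have "((\<lambda>z. \<phi> (?v + inverse c *\<^sub>R (z - y))) has_derivative (\<lambda>h. (inverse c *\<^sub>R h) \<bullet> ?p)) (at y)"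
    using GDERIV_reference by (simp add: gderiv_def)
  then have "((\<lambda>z. f y + c * (\<phi> (?v + inverse c *\<^sub>R (z - y)) - \<phi> ?v)) has_derivative
      (\<lambda>h. h \<bullet> ?p)) (at y)"
    using step_pos by (auto intro!: derivative_eq_intros)
  then show ?thesis
    unfolding gderiv_def aniso_model_eq[OF step_pos] .
qed

text \<open>The descent property is this bound for step-size \<open>1 / L\<close>; shrinking the step-size raises the model.\<close>

lemma f_le_model: "f z \<le> aniso_model \<phi> f c y z"
proof -
  let ?v = "precond_grad \<phi> f y"
  have "1 / L > 0"
    using step_pos step_le by linarith
  have "f z \<le> aniso_model \<phi> f (1 / L) y z"
    using descent by (simp add: anisotropic_descent_def aniso_model_def)
  also have "\<dots> \<le> aniso_model \<phi> f c y z"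
    unfolding aniso_model_eq[OF step_pos] aniso_model_eq[OF \<open>1 / L > 0\<close>]
    using convex_perspective_antimono[OF convex step_pos step_le] by simp
  finally show ?thesis .
qed

lemma g_not_MInf: "g z \<noteq> - \<infinity>"
  using proper by (simp add: proper_function_def)

lemma aniso_envelope_le: "aniso_envelope \<phi> f g c y \<le> objective f g y"
proof -
  have "aniso_envelope \<phi> f g c y \<le> ereal (aniso_model \<phi> f c y y) + g y"
    unfolding aniso_envelope_eq by (rule INF_lower) (rule UNIV_I)
  then show ?thesis
    by (simp add: aniso_model_self[OF step_pos] objective_def)
qed

text \<open>The model agrees with \<open>f\<close> at its base point to first order, so minimality of \<open>y\<close> for the model
at \<open>y\<close> already is a first-order condition for \<open>f + g\<close>.\<close>

lemma stationary_if_model_minimizer: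
  assumes fin: "objective f g y < \<infinity>"
    and min: "\<And>z. objective f g y \<le> ereal (aniso_model \<phi> f c y z) + g z"
  shows "stationary_point f g y"
proof -
  have "\<bar>g y\<bar> \<noteq> \<infinity>"
    using fin g_not_MInf[of y] by (cases "g y") (auto simp: objective_def)
  then have "- gradient f y \<in> regular_subdifferential g y"
    using min by (intro fermat_regular_subdifferential[OF model_GDERIV])
      (simp_all add: objective_def aniso_model_self[OF step_pos])
  then have "- gradient f y \<in> limiting_subdifferential g y"
    using regular_subset_limiting by blast
  then show ?thesis
    unfolding stationary_point_def by (rule rev_image_eqI) simp
qed

end

section \<open>Convergence of the iterates\<close>

lemma telescoping_pigeonhole:
  fixes a :: "nat \<Rightarrow> real"
  assumes "1 \<le> K"
  shows "\<exists>k<K. a k - a (Suc k) \<le> (a 0 - a K) / real K"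
proof (rule ccontr)
  assume "\<not> ?thesis"
  then have "(\<Sum>k<K. (a 0 - a K) / real K) < (\<Sum>k<K. a k - a (Suc k))"
    using assms by (intro sum_strict_mono) (auto simp: not_le lessThan_empty_iff)
  then show False
    using assms by (simp add: sum_lessThan_telescope')
qed

locale anisotropic_prox_grad = anisotropic_composite \<phi> f g L c
  for \<phi> f :: "'a::euclidean_space \<Rightarrow> real" and g :: "'a \<Rightarrow> ereal" and L c :: real +
  fixes x :: "nat \<Rightarrow> 'a"
  assumes iterates: "aniso_prox_grad_iterates \<phi> f g c x"
    and bounded_below: "(INF z. objective f g z) > - \<infinity>"
begin

text \<open>The new iterate minimizes model plus \<open>g\<close>, and the model majorizes \<open>f\<close> at the new iterate. The
comparison point \<open>z\<close> is arbitrary, which is what lets this one inequality yield descent, the gap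
estimate and optimality of limit points.\<close>

lemma objective_step_le:
  "objective f g (x (Suc k)) \<le> ereal (aniso_model \<phi> f c (x k) z) + g z"
proof -
  define y where "y = x k - c *\<^sub>R precond_grad \<phi> f (x k)"
  define b where "b = f (x k) - (c \<star> \<phi>) (c *\<^sub>R precond_grad \<phi> f (x k))"
  have model: "aniso_model \<phi> f c (x k) w = b + (c \<star> \<phi>) (w - y)" for w
    by (simp add: aniso_model_def b_def y_def algebra_simps)
  have "g (x (Suc k)) + ereal ((c \<star> \<phi>) (x (Suc k) - y)) \<le> g z + ereal ((c \<star> \<phi>) (z - y))"
    using iterates unfolding aniso_prox_grad_iterates_def is_arg_min_linorder y_def by metis
  then have "ereal (aniso_model \<phi> f c (x k) (x (Suc k))) + g (x (Suc k))
      \<le> ereal (aniso_model \<phi> f c (x k) z) + g z"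
    unfolding model by (cases "g (x (Suc k))"; cases "g z") auto
  moreover have "objective f g (x (Suc k)) \<le> ereal (aniso_model \<phi> f c (x k) (x (Suc k))) + g (x (Suc k))"
    unfolding objective_def using f_le_model by (intro add_right_mono) simp
  ultimately show ?thesis
    by (rule order_trans[rotated])
qed

lemma objective_step_le_envelope: "objective f g (x (Suc k)) \<le> aniso_envelope \<phi> f g c (x k)"
  unfolding aniso_envelope_eq using objective_step_le by (intro INF_greatest)

lemma objective_decseq: "decseq (\<lambda>k. objective f g (x k))"
  using objective_step_le_envelope aniso_envelope_le by (intro decseq_SucI) (rule order_trans)

text \<open>Only \<open>x 0\<close> can lie outside the domain of \<open>g\<close>: every later iterate beats a point of the domain.\<close>

lemma objective_Suc_finite: "objective f g (x (Suc k)) < \<infinity>"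
proof -
  obtain z where "g z < \<infinity>"
    using proper by (auto simp: proper_function_def edomain_def)
  then have "ereal (aniso_model \<phi> f c (x k) z) + g z < \<infinity>"
    by (cases "g z") auto
  with objective_step_le show ?thesis
    by (rule le_less_trans)
qed

lemma objective_tendsto:
  obtains l where "(\<lambda>k. objective f g (x k)) \<longlonglongrightarrow> ereal l" "\<And>k. ereal l \<le> objective f g (x k)"
proof -
  let ?I = "INF k. objective f g (x k)"
  have "(INF z. objective f g z) \<le> ?I"
    by (rule INF_mono) auto
  moreover have "?I \<le> objective f g (x (Suc 0))"
    by (rule INF_lower) simp
  ultimately obtain l where "?I = ereal l"
    using bounded_below objective_Suc_finite[of 0] by (cases ?I) auto
  then show ?thesis
    using that[of l] LIMSEQ_INF[OF objective_decseq] INF_lower[of _ UNIV "\<lambda>k. objective f g (x k)"]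
    by simp
qed

text \<open>In \<open>l \<le> F (x (Suc (r n))) \<le> m z + g z\<close> the successor iterates are discarded, and \<open>n\<close> occurs
only in the base point \<open>x (r n)\<close> of the model \<open>m\<close>, which depends continuously on it.\<close>

lemma limit_point_stationary:
  assumes r: "strict_mono r" and lim: "(x \<circ> r) \<longlonglongrightarrow> y"
  shows "stationary_point f g y"
proof -
  obtain l where l: "(\<lambda>k. objective f g (x k)) \<longlonglongrightarrow> ereal l" "\<And>k. ereal l \<le> objective f g (x k)"
    using objective_tendsto by blast
  have "(\<lambda>n. objective f g ((x \<circ> r) n)) \<longlonglongrightarrow> ereal l"
    using LIMSEQ_subseq_LIMSEQ[OF l(1) r] by (simp add: o_def)
  then have le: "objective f g y \<le> ereal l"
    by (rule objective_le_lim[OF lsc isCont_f lim])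
  have model: "ereal l \<le> ereal (aniso_model \<phi> f c y z) + g z" for z
  proof (cases "g z")
    case (real b)
    have "l \<le> aniso_model \<phi> f c ((x \<circ> r) n) z + b" for n
      using order_trans[OF l(2) objective_step_le, of "r n" z] real by simp
    moreover have "(\<lambda>n. aniso_model \<phi> f c ((x \<circ> r) n) z + b) \<longlonglongrightarrow> aniso_model \<phi> f c y z + b"
      by (intro tendsto_intros model_tendsto lim)
    ultimately have "l \<le> aniso_model \<phi> f c y z + b"
      by (intro LIMSEQ_le_const) auto
    then show ?thesis
      using real by simp
  qed (use g_not_MInf in auto)
  show ?thesis
  proof (rule stationary_if_model_minimizer)
    show "objective f g y < \<infinity>"
      using le by (rule le_less_trans) simp
    show "objective f g y \<le> ereal (aniso_model \<phi> f c y z) + g z" for z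
      using le model by (rule order_trans)
  qed
qed

text \<open>The envelope at \<open>x k\<close> is at least the next objective value, so each gap is at most the decrease
divided by \<open>c\<close>. One of the first \<open>K\<close> decreases is at most their mean.\<close>

lemma min_gap_le:
  assumes K: "1 \<le> K"
  shows "Min ((\<lambda>k. regularized_gap \<phi> f g (x k) c) ` {0..K - 1})
    \<le> ereal (1 / (c * real K)) * (objective f g (x 0) - (INF z. objective f g z))"
proof -
  let ?m = "INF z. objective f g z"
  have le: "?m \<le> objective f g z" for z
    using INF_lower[of z UNIV "objective f g"] by simp
  have "?m < \<infinity>"
    using le objective_Suc_finite[of 0] by (rule le_less_trans)
  then obtain m where m: "?m = ereal m"
    using bounded_below by (cases ?m) simp_all
  have m_le: "ereal m \<le> objective f g z" for z
    using le unfolding m .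
  show ?thesis
  proof (cases "objective f g (x 0)")
    case PInf
    \<comment> \<open>an infeasible starting point makes the right-hand side infinite\<close>
    then show ?thesis
      using step_pos K m by simp
  next
    case MInf
    then show ?thesis
      using m_le[of "x 0"] by simp
  next
    case (real a0)
    define a where "a k = real_of_ereal (objective f g (x k))" for k
    have a: "objective f g (x k) = ereal (a k)" for k
    proof -
      have "objective f g (x k) < \<infinity>"
        using real objective_Suc_finite by (cases k) auto
      then show ?thesis
        using m_le[of "x k"] by (cases "objective f g (x k)") (auto simp: a_def)
    qed
    have gap: "regularized_gap \<phi> f g (x k) c \<le> ereal (1 / c * (a k - a (Suc k)))" for k
    proof -
      have "objective f g (x k) - aniso_envelope \<phi> f g c (x k) \<le> ereal (a k) - ereal (a (Suc k))"
        using objective_step_le_envelope[of k] by (intro ereal_minus_mono) (simp_all add: a)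
      then have "regularized_gap \<phi> f g (x k) c \<le> ereal (1 / c) * (ereal (a k) - ereal (a (Suc k)))"
        unfolding regularized_gap_def using step_pos by (intro ereal_mult_left_mono) auto
      then show ?thesis by simp
    qed
    obtain k where k: "k < K" "a k - a (Suc k) \<le> (a 0 - a K) / real K"
      using telescoping_pigeonhole[OF K] by blast
    have "Min ((\<lambda>k. regularized_gap \<phi> f g (x k) c) ` {0..K - 1}) \<le> regularized_gap \<phi> f g (x k) c"
      using k(1) by (intro Min_le) auto
    also have "\<dots> \<le> ereal (1 / c * (a k - a (Suc k)))"
      by (rule gap)
    also have "1 / c * (a k - a (Suc k)) \<le> 1 / c * ((a 0 - m) / real K)"
    proof -
      have "m \<le> a K"
        using m_le[of "x K"] by (simp add: a)
      then have "(a 0 - a K) / real K \<le> (a 0 - m) / real K"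
        by (intro divide_right_mono) auto
      then show ?thesis
        using k(2) step_pos by (intro mult_left_mono) auto
    qed
    finally show ?thesis
      by (simp add: m a)
  qed
qed

end

theorem theorem5p3:
  fixes \<phi> f :: "real ^ 'n \<Rightarrow> real"
    and g :: "real ^ 'n \<Rightarrow> ereal"
    and L lam :: real
    and x :: "nat \<Rightarrow> real ^ 'n"
  assumes phi_convex: "convex_on UNIV \<phi>"
    and phi_legendre: "legendre (\<lambda>z. ereal (\<phi> z))"
    and f_C1: "C1_function f"
    and L_pos: "0 < L"
    and f_descent: "anisotropic_descent \<phi> f L"
    and g_proper: "proper_function g"
    and g_lsc: "lower_semicontinuous g"
    and F_bounded_below: "(INF z. objective f g z) > -\<infinity>"
    and threshold_pos: "0 < prox_threshold \<phi> g"
    and lam_pos: "0 < lam"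
    and lam_threshold: "ereal lam < prox_threshold \<phi> g"
    and lam_L: "lam \<le> 1 / L"
    and iterates: "aniso_prox_grad_iterates \<phi> f g lam x"
  shows "decseq (\<lambda>k. objective f g (x k)) \<and>
    (\<exists>l::real. (\<lambda>k. objective f g (x k)) \<longlonglongrightarrow> ereal l) \<and>
    (\<forall>xs. (\<exists>r. strict_mono r \<and> (x \<circ> r) \<longlonglongrightarrow> xs) \<longrightarrow> stationary_point f g xs) \<and>
    (\<forall>K::nat. K \<ge> 1 \<longrightarrow>
       Min ((\<lambda>k. regularized_gap \<phi> f g (x k) lam) ` {0..K - 1})
         \<le> ereal (1 / (lam * real K)) * (objective f g (x 0) - (INF z. objective f g z)))"
proof -
  interpret anisotropic_prox_grad \<phi> f g L lam x
    by unfold_locales (fact assms)+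
  obtain l where "(\<lambda>k. objective f g (x k)) \<longlonglongrightarrow> ereal l"
    using objective_tendsto by blast
  then have conv: "\<exists>l::real. (\<lambda>k. objective f g (x k)) \<longlonglongrightarrow> ereal l" ..
  have stat: "\<forall>xs. (\<exists>r. strict_mono r \<and> (x \<circ> r) \<longlonglongrightarrow> xs) \<longrightarrow> stationary_point f g xs"
    using limit_point_stationary by blast
  have gap: "\<forall>K::nat. K \<ge> 1 \<longrightarrow>
       Min ((\<lambda>k. regularized_gap \<phi> f g (x k) lam) ` {0..K - 1})
         \<le> ereal (1 / (lam * real K)) * (objective f g (x 0) - (INF z. objective f g z))"
    by (intro allI impI min_gap_le)
  show ?thesis
    by (intro conjI objective_decseq conv stat gap)
qed

end
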